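(* Let $R$ be a ring and let $I$ be a regular ideal of $R$. Then the following are equivalent: (1) $I$ is square stable. (2) $eRe$ is strongly regular for all idempotents $e\in I$.
   Context: All rings are associative with identity and all ideals are two-sided. An ideal $I$ of a ring $R$ is square stable if whenever $aR+bR=R$ with $a\in I$ and $b\in R$, there exists $y\in R$ such that $a^2+by$ is a unit of $R$. An element $a\in R$ is regular if $a=axa$ for some $x\in R$, and strongly regular if $a\in a^2R\cap Ra^2$. An ideal $I$ is regular if every element of $I$ is regular. A ring is strongly regular if every element of it is strongly regular; $eRe$ is regarded as a ring with identity $e$. *)

theory Defs
  imports "HOL-Algebra.Ideal"
begin

definition regular_element :: "('a, 'm) ring_scheme \<Rightarrow> 'a \<Rightarrow> bool" where
  "regular_element R a \<longleftrightarrow> (\<exists>x\<in>carrier R. a = a \<otimes>\<^bsub>R\<^esub> x \<otimes>\<^bsub>R\<^esub> a)"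

definition regular_ideal :: "('a, 'm) ring_scheme \<Rightarrow> 'a set \<Rightarrow> bool" where
  "regular_ideal R I \<longleftrightarrow> ideal I R \<and> (\<forall>a\<in>I. regular_element R a)"

(* The cosets "a <# carrier R" and "carrier R #> a" are multiplicative: they are aR and Ra. *)

definition square_stable :: "('a, 'm) ring_scheme \<Rightarrow> 'a set \<Rightarrow> bool" where
  "square_stable R I \<longleftrightarrow> ideal I R \<and>
     (\<forall>a\<in>I. \<forall>b\<in>carrier R.
        (a <#\<^bsub>R\<^esub> carrier R) <+>\<^bsub>R\<^esub> (b <#\<^bsub>R\<^esub> carrier R) = carrier R \<longrightarrow>
        (\<exists>y\<in>carrier R. a [^]\<^bsub>R\<^esub> (2::nat) \<oplus>\<^bsub>R\<^esub> b \<otimes>\<^bsub>R\<^esub> y \<in> Units R))"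

definition strongly_regular_element :: "('a, 'm) ring_scheme \<Rightarrow> 'a \<Rightarrow> bool" where
  "strongly_regular_element R a \<longleftrightarrow>
     a \<in> (a [^]\<^bsub>R\<^esub> (2::nat) <#\<^bsub>R\<^esub> carrier R) \<inter> (carrier R #>\<^bsub>R\<^esub> a [^]\<^bsub>R\<^esub> (2::nat))"

definition strongly_regular_ring :: "('a, 'm) ring_scheme \<Rightarrow> bool" where
  "strongly_regular_ring R \<longleftrightarrow> ring R \<and> (\<forall>a\<in>carrier R. strongly_regular_element R a)"

definition idempotent_element :: "('a, 'm) ring_scheme \<Rightarrow> 'a \<Rightarrow> bool" where
  "idempotent_element R e \<longleftrightarrow> e \<in> carrier R \<and> e \<otimes>\<^bsub>R\<^esub> e = e"

definition corner_ring :: "('a, 'm) ring_scheme \<Rightarrow> 'a \<Rightarrow> ('a, 'm) ring_scheme" where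
  "corner_ring R e =
     R\<lparr>carrier := {e \<otimes>\<^bsub>R\<^esub> x \<otimes>\<^bsub>R\<^esub> e | x. x \<in> carrier R}, one := e\<rparr>"

lemma (in ring) corner_ring_is_ring:
  assumes "idempotent_element R e"
  shows "ring (corner_ring R e)"
proof -
  have e: "e \<in> carrier R" "e \<otimes> e = e"
    using assms by (auto simp: idempotent_element_def)
  define C where "C = {e \<otimes> x \<otimes> e | x. x \<in> carrier R}"
  have sub: "x \<in> carrier R" if "x \<in> C" for x
    using that e by (auto simp: C_def)
  have mem: "x \<in> C \<longleftrightarrow> x \<in> carrier R \<and> e \<otimes> x = x \<and> x \<otimes> e = x" for x
  proof
    assume "x \<in> C"
    then obtain y where y: "y \<in> carrier R" "x = e \<otimes> y \<otimes> e" by (auto simp: C_def)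
    have "e \<otimes> x = (e \<otimes> e) \<otimes> y \<otimes> e" "x \<otimes> e = e \<otimes> y \<otimes> (e \<otimes> e)"
      unfolding y(2) using y(1) e(1) by (simp_all only: m_assoc m_closed)
    then show "x \<in> carrier R \<and> e \<otimes> x = x \<and> x \<otimes> e = x"
      using e y by simp
  next
    assume x: "x \<in> carrier R \<and> e \<otimes> x = x \<and> x \<otimes> e = x"
    then have "x = e \<otimes> x \<otimes> e" by simp
    with x show "x \<in> C" unfolding C_def by blast
  qed
  have corner: "corner_ring R e = R\<lparr>carrier := C, one := e\<rparr>"
    by (simp add: corner_ring_def C_def)
  have zero: "\<zero> \<in> C" and one: "e \<in> C"
    using e by (auto simp: mem)
  have add: "x \<oplus> y \<in> C" if "x \<in> C" "y \<in> C" for x y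
    using that e by (simp add: mem l_distr r_distr)
  have neg: "\<ominus> x \<in> C" if "x \<in> C" for x
    using that e by (simp add: mem l_minus r_minus)
  have mult: "x \<otimes> y \<in> C" if "x \<in> C" "y \<in> C" for x y
    using that e by (simp add: mem) (metis m_assoc)
  show ?thesis
  proof (rule ringI)
    show "abelian_group (corner_ring R e)"
    proof (rule abelian_groupI)
      fix x assume "x \<in> carrier (corner_ring R e)"
      then have "x \<in> C" by (simp add: corner)
      then have "\<ominus> x \<in> C" "\<ominus> x \<oplus> x = \<zero>"
        using neg sub l_neg by blast+
      then show "\<exists>y\<in>carrier (corner_ring R e).
          y \<oplus>\<^bsub>corner_ring R e\<^esub> x = \<zero>\<^bsub>corner_ring R e\<^esub>"
        by (auto simp: corner)
    qed (use zero add sub a_assoc a_comm in \<open>auto simp: corner\<close>)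
    show "monoid (corner_ring R e)"
      by (rule monoidI) (use one mult in \<open>auto simp: corner mem m_assoc\<close>)
  qed (use sub in \<open>auto simp: corner l_distr r_distr\<close>)
qed

end

theory Submission
  imports Defs
begin

text \<open>
  Both conditions say the same thing about the regular ideal \<open>I\<close>: it is reduced, that is, it
  contains no nonzero element of square zero.

  If \<open>a = axa\<close>, then \<open>aR + (1 - ax)R = R\<close>, and square stability supplies a unit
  \<open>a\<^sup>2 + (1 - ax)y\<close>. When \<open>a\<^sup>2 = 0\<close> this unit is annihilated on the left by the idempotent \<open>ax\<close>,
  so \<open>ax = 0\<close> and \<open>a = 0\<close> (\<open>square_stable_imp_reduced\<close>). On the other side, a square-zero
  element of \<open>I\<close> lies in a corner \<open>eRe\<close> with \<open>e \<in> I\<close> (\<open>square_zero_in_corner\<close>), and a strongly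
  regular ring is reduced (\<open>strongly_regular_corners_imp_reduced\<close>).

  The two converses use that the idempotents of a reduced ideal are central in \<open>R\<close>. Hence for
  \<open>a = axa\<close> in \<open>I\<close> the elements \<open>ax\<close> and \<open>xa\<close> are the same central idempotent \<open>g\<close>
  (\<open>reduced_quasi_inverse_commutes\<close>). Strong regularity of the corners is then immediate. For
  square stability, \<open>R\<close> splits as \<open>gR \<times> (1 - g)R\<close>; the element \<open>a\<close> is invertible on the first
  factor and zero on the second, where \<open>ar + bs = 1\<close> therefore becomes \<open>bs = 1\<close>. So
  \<open>y = s(1 - g)\<close> gives \<open>a\<^sup>2 + by = a\<^sup>2 + (1 - g) = (a + (1 - g))\<^sup>2\<close>, the square of a unit.
\<close>

section \<open>Idempotents and corner rings\<close>

definition reduced_ideal :: "('a, 'm) ring_scheme \<Rightarrow> 'a set \<Rightarrow> bool" where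
  "reduced_ideal R I \<longleftrightarrow> ideal I R \<and> (\<forall>a\<in>I. a \<otimes>\<^bsub>R\<^esub> a = \<zero>\<^bsub>R\<^esub> \<longrightarrow> a = \<zero>\<^bsub>R\<^esub>)"

context ring
begin

lemma square_eq_mult:
  assumes "a \<in> carrier R"
  shows "a [^] (2::nat) = a \<otimes> a"
  using assms by (simp add: numeral_2_eq_2)

lemma idempotent_complement:
  assumes "idempotent_element R g"
  shows "g \<otimes> (\<one> \<ominus> g) = \<zero>" "(\<one> \<ominus> g) \<otimes> g = \<zero>" "(\<one> \<ominus> g) \<otimes> (\<one> \<ominus> g) = \<one> \<ominus> g"
    "g \<oplus> (\<one> \<ominus> g) = \<one>"
proof -
  have g: "g \<in> carrier R" "g \<otimes> g = g"
    using assms by (auto simp: idempotent_element_def)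
  show 1: "g \<otimes> (\<one> \<ominus> g) = \<zero>" and 2: "(\<one> \<ominus> g) \<otimes> g = \<zero>"
    using g by (simp_all add: minus_eq l_distr r_distr l_minus r_minus r_neg)
  have "(\<one> \<ominus> g) \<otimes> (\<one> \<ominus> g) = \<one> \<otimes> (\<one> \<ominus> g) \<ominus> g \<otimes> (\<one> \<ominus> g)"
    using g(1) by (simp add: minus_eq l_distr l_minus del: l_one)
  then show "(\<one> \<ominus> g) \<otimes> (\<one> \<ominus> g) = \<one> \<ominus> g"
    using g(1) 1 by (simp add: minus_eq)
  show "g \<oplus> (\<one> \<ominus> g) = \<one>"
    using g(1) by (simp add: minus_eq a_lcomm[of g \<one>] r_neg)
qed

lemma quasi_inverse_idempotents:
  assumes "a \<in> carrier R" "x \<in> carrier R" "a = a \<otimes> x \<otimes> a"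
  shows "idempotent_element R (a \<otimes> x)" "idempotent_element R (x \<otimes> a)"
proof -
  have "(a \<otimes> x) \<otimes> (a \<otimes> x) = (a \<otimes> x \<otimes> a) \<otimes> x" "(x \<otimes> a) \<otimes> (x \<otimes> a) = x \<otimes> (a \<otimes> x \<otimes> a)"
    using assms(1,2) by (simp_all add: m_assoc)
  then show "idempotent_element R (a \<otimes> x)" "idempotent_element R (x \<otimes> a)"
    using assms by (simp_all add: idempotent_element_def)
qed

lemma corner_carrier_iff:
  assumes "idempotent_element R e"
  shows "x \<in> carrier (corner_ring R e) \<longleftrightarrow> x \<in> carrier R \<and> e \<otimes> x = x \<and> x \<otimes> e = x"
proof -
  have e: "e \<in> carrier R" "e \<otimes> e = e"
    using assms by (auto simp: idempotent_element_def)
  show ?thesis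
  proof
    assume "x \<in> carrier (corner_ring R e)"
    then obtain y where y: "y \<in> carrier R" "x = e \<otimes> y \<otimes> e"
      by (auto simp: corner_ring_def)
    have "e \<otimes> x = (e \<otimes> e) \<otimes> y \<otimes> e" "x \<otimes> e = e \<otimes> y \<otimes> (e \<otimes> e)"
      unfolding y(2) using y(1) e(1) by (simp_all only: m_assoc m_closed)
    then show "x \<in> carrier R \<and> e \<otimes> x = x \<and> x \<otimes> e = x"
      using e y by simp
  next
    assume x: "x \<in> carrier R \<and> e \<otimes> x = x \<and> x \<otimes> e = x"
    then have "x = e \<otimes> x \<otimes> e" by simp
    with x have "\<exists>y. x = e \<otimes> y \<otimes> e \<and> y \<in> carrier R" by blast
    then show "x \<in> carrier (corner_ring R e)"
      by (simp add: corner_ring_def)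
  qed
qed

lemma strongly_regular_corner_element_iff:
  assumes e: "idempotent_element R e" and a: "a \<in> carrier (corner_ring R e)"
  shows "strongly_regular_element (corner_ring R e) a \<longleftrightarrow>
    (\<exists>x\<in>carrier (corner_ring R e). a = a \<otimes> a \<otimes> x) \<and>
    (\<exists>x\<in>carrier (corner_ring R e). a = x \<otimes> (a \<otimes> a))"
proof -
  have "a [^]\<^bsub>corner_ring R e\<^esub> (2::nat) = e \<otimes> a \<otimes> a"
    by (simp add: corner_ring_def numeral_2_eq_2 nat_pow_def)
  also have "\<dots> = a \<otimes> a"
    using a corner_carrier_iff[OF e] by simp
  finally have sq: "a [^]\<^bsub>corner_ring R e\<^esub> (2::nat) = a \<otimes> a" .
  have mult: "mult (corner_ring R e) = mult R"
    by (simp add: corner_ring_def)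
  show ?thesis
    unfolding strongly_regular_element_def sq by (auto simp: l_coset_def r_coset_def mult)
qed

section \<open>Reduced regular ideals\<close>

text \<open>
  For an idempotent \<open>g\<close> both \<open>gr(1 - g)\<close> and \<open>(1 - g)rg\<close> have square zero, so that
  \<open>gr = grg = rg\<close>. Only the two products have to lie in the ideal, which is why \<open>r\<close> may
  range over the whole ring.
\<close>

lemma reduced_ideal_idempotent_central:
  assumes I: "reduced_ideal R I" and g: "idempotent_element R g" "g \<in> I"
    and r: "r \<in> carrier R"
  shows "g \<otimes> r = r \<otimes> g"
proof -
  interpret I: ideal I R using I by (simp add: reduced_ideal_def)
  define p where "p = \<one> \<ominus> g"
  have gc: "g \<in> carrier R" using g by (simp add: idempotent_element_def)
  then have pc: "p \<in> carrier R" by (simp add: p_def)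
  have gp: "g \<otimes> p = \<zero>" and pg: "p \<otimes> g = \<zero>"
    using idempotent_complement[OF g(1)] by (simp_all add: p_def)
  have "(g \<otimes> r \<otimes> p) \<otimes> (g \<otimes> r \<otimes> p) = g \<otimes> r \<otimes> (p \<otimes> g) \<otimes> (r \<otimes> p)"
    using gc pc r by (simp only: m_assoc m_closed)
  then have sq1: "(g \<otimes> r \<otimes> p) \<otimes> (g \<otimes> r \<otimes> p) = \<zero>"
    using pg gc pc r by simp
  have "(p \<otimes> r \<otimes> g) \<otimes> (p \<otimes> r \<otimes> g) = p \<otimes> r \<otimes> (g \<otimes> p) \<otimes> (r \<otimes> g)"
    using gc pc r by (simp only: m_assoc m_closed)
  then have sq2: "(p \<otimes> r \<otimes> g) \<otimes> (p \<otimes> r \<otimes> g) = \<zero>"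
    using gp gc pc r by simp
  have "g \<otimes> r \<otimes> p \<in> I" "p \<otimes> r \<otimes> g \<in> I"
    using g(2) r pc by (simp_all add: I.I_r_closed I.I_l_closed)
  with sq1 sq2 I have z: "g \<otimes> r \<otimes> p = \<zero>" "p \<otimes> r \<otimes> g = \<zero>"
    by (auto simp: reduced_ideal_def)
  have "g \<otimes> r = g \<otimes> r \<otimes> (g \<oplus> p)" "r \<otimes> g = (g \<oplus> p) \<otimes> r \<otimes> g"
    using idempotent_complement(4)[OF g(1)] gc r by (simp_all add: p_def)
  then have "g \<otimes> r = g \<otimes> r \<otimes> g" "r \<otimes> g = g \<otimes> r \<otimes> g"
    using z gc pc r by (simp_all add: l_distr r_distr)
  then show ?thesis by simp
qed

lemma reduced_quasi_inverse_commutes: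
  assumes I: "reduced_ideal R I" and a: "a \<in> I" and x: "x \<in> carrier R" "a = a \<otimes> x \<otimes> a"
  shows "a \<otimes> x = x \<otimes> a"
proof -
  interpret I: ideal I R using I by (simp add: reduced_ideal_def)
  have ac: "a \<in> carrier R" using a by (rule I.Icarr)
  have idem: "idempotent_element R (a \<otimes> x)" "idempotent_element R (x \<otimes> a)"
    using quasi_inverse_idempotents[OF ac x] .
  have in_I: "a \<otimes> x \<in> I" "x \<otimes> a \<in> I"
    using a x(1) by (simp_all add: I.I_r_closed I.I_l_closed)
  have "a \<otimes> x = (a \<otimes> x \<otimes> a) \<otimes> x" using x by simp
  also have "\<dots> = a \<otimes> ((x \<otimes> a) \<otimes> x)"
    using ac x(1) by (simp only: m_assoc m_closed)
  also have "(x \<otimes> a) \<otimes> x = x \<otimes> (x \<otimes> a)"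
    using reduced_ideal_idempotent_central[OF I idem(2) in_I(2) x(1)] .
  also have "a \<otimes> (x \<otimes> (x \<otimes> a)) = (a \<otimes> x) \<otimes> (x \<otimes> a)"
    using ac x(1) by (simp only: m_assoc m_closed)
  also have "\<dots> = ((a \<otimes> x) \<otimes> x) \<otimes> a"
    using ac x(1) by (simp only: m_assoc m_closed)
  also have "(a \<otimes> x) \<otimes> x = x \<otimes> (a \<otimes> x)"
    using reduced_ideal_idempotent_central[OF I idem(1) in_I(1) x(1)] .
  also have "x \<otimes> (a \<otimes> x) \<otimes> a = x \<otimes> (a \<otimes> x \<otimes> a)"
    using ac x(1) by (simp only: m_assoc m_closed)
  also have "\<dots> = x \<otimes> a" using x by simp
  finally show ?thesis .
qed

section \<open>Square stability and reducedness\<close>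

lemma square_stable_imp_reduced:
  assumes reg: "regular_ideal R I" and st: "square_stable R I"
  shows "reduced_ideal R I"
proof -
  interpret I: ideal I R using reg by (simp add: regular_ideal_def)
  have "a = \<zero>" if a: "a \<in> I" and sq: "a \<otimes> a = \<zero>" for a
  proof -
    have ac: "a \<in> carrier R" using a by (rule I.Icarr)
    obtain x where x: "x \<in> carrier R" "a = a \<otimes> x \<otimes> a"
      using reg a by (auto simp: regular_ideal_def regular_element_def)
    define b where "b = \<one> \<ominus> a \<otimes> x"
    have bc: "b \<in> carrier R" using ac x(1) by (simp add: b_def)
    have axb: "(a \<otimes> x) \<otimes> b = \<zero>"
      using idempotent_complement(1)[OF quasi_inverse_idempotents(1)[OF ac x]]
      by (simp add: b_def)
    have "(a <# carrier R) <+> (b <# carrier R) = carrier R"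
    proof
      show "(a <# carrier R) <+> (b <# carrier R) \<subseteq> carrier R"
        using ac bc by (auto simp: set_add_def set_mult_def l_coset_def)
      show "carrier R \<subseteq> (a <# carrier R) <+> (b <# carrier R)"
      proof
        fix r assume r: "r \<in> carrier R"
        have "b \<otimes> r = r \<ominus> a \<otimes> (x \<otimes> r)"
          using ac x(1) r by (simp add: b_def minus_eq l_distr l_minus m_assoc)
        then have "r = a \<otimes> (x \<otimes> r) \<oplus> b \<otimes> r"
          using ac x(1) r by (simp add: minus_eq a_lcomm r_neg)
        then show "r \<in> (a <# carrier R) <+> (b <# carrier R)"
          using x(1) r unfolding set_add_def set_mult_def l_coset_def by auto
      qed
    qed
    with st a bc obtain y where y: "y \<in> carrier R" "a [^] (2::nat) \<oplus> b \<otimes> y \<in> Units R"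
      unfolding square_stable_def by blast
    then have u: "b \<otimes> y \<in> Units R"
      using sq ac bc by (simp add: square_eq_mult)
    have "a \<otimes> x = a \<otimes> x \<otimes> ((b \<otimes> y) \<otimes> inv (b \<otimes> y))"
      using u ac x(1) by simp
    also have "\<dots> = (a \<otimes> x \<otimes> b) \<otimes> (y \<otimes> inv (b \<otimes> y))"
      using u ac x(1) bc y(1) Units_inv_closed[OF u] by (simp only: m_assoc m_closed)
    also have "\<dots> = \<zero>"
      using axb y(1) Units_inv_closed[OF u] by simp
    finally have "a \<otimes> x = \<zero>" .
    then show "a = \<zero>" using x(2) ac by simp
  qed
  then show ?thesis by (simp add: reduced_ideal_def I.ideal_axioms)
qed

text \<open>
  With \<open>g = ax = xa\<close>, the unit is the square of \<open>u = a + (1 - g)\<close>, whose inverse is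
  \<open>xg + (1 - g)\<close>: both are computed separately on the orthogonal pieces \<open>g\<close> and \<open>1 - g\<close>.
\<close>

lemma reduced_imp_square_stable:
  assumes reg: "regular_ideal R I" and I: "reduced_ideal R I"
  shows "square_stable R I"
proof -
  interpret I: ideal I R using reg by (simp add: regular_ideal_def)
  have "\<exists>y\<in>carrier R. a [^] (2::nat) \<oplus> b \<otimes> y \<in> Units R"
    if a: "a \<in> I" and b: "b \<in> carrier R"
      and sum: "(a <# carrier R) <+> (b <# carrier R) = carrier R" for a b
  proof -
    have ac: "a \<in> carrier R" using a by (rule I.Icarr)
    obtain x where x: "x \<in> carrier R" "a = a \<otimes> x \<otimes> a"
      using reg a by (auto simp: regular_ideal_def regular_element_def)
    have "\<one> \<in> (a <# carrier R) <+> (b <# carrier R)" using sum by simp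
    then obtain r s where rs: "r \<in> carrier R" "s \<in> carrier R" "\<one> = a \<otimes> r \<oplus> b \<otimes> s"
      unfolding set_add_def set_mult_def l_coset_def by auto
    define g where "g = a \<otimes> x"
    define p where "p = \<one> \<ominus> g"
    define v where "v = x \<otimes> g"
    have gc: "g \<in> carrier R" and pc: "p \<in> carrier R" and vc: "v \<in> carrier R"
      using ac x(1) by (simp_all add: g_def p_def v_def)
    have idem: "idempotent_element R g"
      unfolding g_def using quasi_inverse_idempotents(1)[OF ac x] .
    have gI: "g \<in> I" unfolding g_def using a x(1) by (rule I.I_r_closed)
    have central: "g \<otimes> t = t \<otimes> g" if "t \<in> carrier R" for t
      using reduced_ideal_idempotent_central[OF I idem gI that] .
    have gg: "g \<otimes> g = g" using idem by (simp add: idempotent_element_def)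
    have pp: "p \<otimes> p = p" and gp: "g \<otimes> p = \<zero>" and pg: "p \<otimes> g = \<zero>"
      using idempotent_complement[OF idem] by (simp_all add: p_def)
    have pcentral: "p \<otimes> t = t \<otimes> p" if "t \<in> carrier R" for t
      using that gc central[OF that]
      by (simp add: p_def minus_eq l_distr r_distr l_minus r_minus)
    have ga: "g \<otimes> a = a" unfolding g_def using x(2) by simp
    have "a \<otimes> p = (a \<otimes> g) \<otimes> p" using ga central[OF ac] by simp
    also have "\<dots> = \<zero>" using gp ac gc pc by (simp add: m_assoc)
    finally have ap: "a \<otimes> p = \<zero>" .
    have pa: "p \<otimes> a = \<zero>" using ap pcentral[OF ac] by simp
    have vp: "v \<otimes> p = \<zero>" unfolding v_def using gp x(1) gc pc by (simp add: m_assoc)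
    have pv: "p \<otimes> v = \<zero>" using vp pcentral[OF vc] by simp
    have av: "a \<otimes> v = g"
      unfolding v_def using ac x(1) gc gg by (simp add: m_assoc[symmetric] g_def[symmetric])
    have "v \<otimes> a = x \<otimes> a" unfolding v_def using ac x(1) gc ga by (simp add: m_assoc)
    then have va: "v \<otimes> a = g"
      using reduced_quasi_inverse_commutes[OF I a x] by (simp add: g_def)
    have gp1: "g \<oplus> p = \<one>"
      using idempotent_complement(4)[OF idem] by (simp add: p_def)
    define u where "u = a \<oplus> p"
    have uc: "u \<in> carrier R" using ac pc by (simp add: u_def)
    have "u \<otimes> (v \<oplus> p) = \<one>" "(v \<oplus> p) \<otimes> u = \<one>"
      using ac vc pc av va ap pa vp pv pp gc gp1 by (simp_all add: u_def l_distr r_distr)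
    then have "u \<in> Units R"
      using uc vc pc unfolding Units_def by blast
    then have unit: "u \<otimes> u \<in> Units R" by (simp add: Units_m_closed)
    have uu: "u \<otimes> u = a \<otimes> a \<oplus> p"
      using ac pc ap pa pp by (simp add: u_def l_distr r_distr)
    \<comment> \<open>On the piece \<open>1 - g\<close>, where \<open>a\<close> vanishes, \<open>s\<close> is a right inverse of \<open>b\<close>.\<close>
    have "p = (a \<otimes> r \<oplus> b \<otimes> s) \<otimes> p" using rs(3)[symmetric] pc by simp
    also have "\<dots> = a \<otimes> (r \<otimes> p) \<oplus> b \<otimes> (s \<otimes> p)"
      using ac b rs(1,2) pc by (simp add: l_distr m_assoc)
    also have "a \<otimes> (r \<otimes> p) = (a \<otimes> p) \<otimes> r"
      using ac rs(1) pc pcentral[OF rs(1)] by (simp add: m_assoc)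
    also have "\<dots> = \<zero>" using ap rs(1) by simp
    finally have "p = b \<otimes> (s \<otimes> p)" using b rs(2) pc by simp
    then have "a [^] (2::nat) \<oplus> b \<otimes> (s \<otimes> p) \<in> Units R"
      using unit uu ac by (simp add: square_eq_mult)
    then show ?thesis using rs(2) pc by blast
  qed
  then show ?thesis by (simp add: square_stable_def I.ideal_axioms)
qed

section \<open>Strongly regular corners and reducedness\<close>

lemma reduced_imp_strongly_regular_corner:
  assumes reg: "regular_ideal R I" and I: "reduced_ideal R I"
    and e: "idempotent_element R e" "e \<in> I"
  shows "strongly_regular_ring (corner_ring R e)"
proof -
  interpret I: ideal I R using reg by (simp add: regular_ideal_def)
  have ec: "e \<in> carrier R" using e(2) by (rule I.Icarr)
  have "strongly_regular_element (corner_ring R e) a" if a: "a \<in> carrier (corner_ring R e)" for a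
  proof -
    have ac: "a \<in> carrier R" and ea: "e \<otimes> a = a" and ae: "a \<otimes> e = a"
      using a corner_carrier_iff[OF e(1)] by auto
    have aI: "a \<in> I" using I.I_r_closed[OF e(2) ac] ea by simp
    obtain x where x: "x \<in> carrier R" "a = a \<otimes> x \<otimes> a"
      using reg aI by (auto simp: regular_ideal_def regular_element_def)
    define z where "z = e \<otimes> x \<otimes> e"
    have zc: "z \<in> carrier R" using ec x(1) by (simp add: z_def)
    have zC: "z \<in> carrier (corner_ring R e)"
      using x(1) by (auto simp: corner_ring_def z_def)
    have "a \<otimes> z \<otimes> a = (a \<otimes> e) \<otimes> x \<otimes> (e \<otimes> a)"
      unfolding z_def using ac ec x(1) by (simp only: m_assoc m_closed)
    then have z: "a = a \<otimes> z \<otimes> a" using ea ae x(2) by simp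
    have comm: "a \<otimes> z = z \<otimes> a"
      using reduced_quasi_inverse_commutes[OF I aI zc z] .
    have "a = a \<otimes> (z \<otimes> a)" using z ac zc by (simp add: m_assoc)
    then have "a = a \<otimes> a \<otimes> z" using comm ac zc by (simp add: m_assoc)
    moreover have "a = z \<otimes> (a \<otimes> a)" using z comm ac zc by (simp add: m_assoc)
    ultimately show ?thesis
      using strongly_regular_corner_element_iff[OF e(1) a] zC by blast
  qed
  then show ?thesis
    by (simp add: strongly_regular_ring_def corner_ring_is_ring[OF e(1)])
qed

text \<open>
  Put \<open>g = ax\<close> and \<open>h = xa\<close>, so that \<open>ga = a = ah\<close>. Since \<open>hg = xa\<^sup>2x = 0\<close>, the product
  \<open>(1 - g)(1 - h)\<close> is idempotent, and it is annihilated by \<open>h\<close> from the left and by \<open>g\<close> from the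
  right. Its complement \<open>e = g + (1 - g)h\<close> thus satisfies \<open>eg = g\<close> and \<open>he = h\<close>; it is this
  second form that shows \<open>e \<in> I\<close>.
\<close>

lemma square_zero_in_corner:
  assumes I: "ideal I R" and a: "a \<in> I" "a \<otimes> a = \<zero>"
    and x: "x \<in> carrier R" "a = a \<otimes> x \<otimes> a"
  obtains e where "e \<in> I" "idempotent_element R e" "a \<in> carrier (corner_ring R e)"
proof -
  interpret I: ideal I R by (rule I)
  have ac: "a \<in> carrier R" using a(1) by (rule I.Icarr)
  define g where "g = a \<otimes> x"
  define h where "h = x \<otimes> a"
  define p where "p = \<one> \<ominus> g"
  define e where "e = g \<oplus> p \<otimes> h"
  have gc: "g \<in> carrier R" and hc: "h \<in> carrier R"
    using ac x(1) by (simp_all add: g_def h_def)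
  have pc: "p \<in> carrier R" using gc by (simp add: p_def)
  have ec: "e \<in> carrier R" using gc hc pc by (simp add: e_def)
  have idem: "idempotent_element R g" "idempotent_element R h"
    unfolding g_def h_def using quasi_inverse_idempotents[OF ac x] .
  have gg: "g \<otimes> g = g" and hh: "h \<otimes> h = h"
    using idem by (simp_all add: idempotent_element_def)
  have gp: "g \<otimes> p = \<zero>" and pp: "p \<otimes> p = p"
    using idempotent_complement[OF idem(1)] by (simp_all add: p_def)
  have "h \<otimes> g = x \<otimes> (a \<otimes> a) \<otimes> x"
    unfolding g_def h_def using ac x(1) by (simp only: m_assoc m_closed)
  then have hg: "h \<otimes> g = \<zero>" using a(2) x(1) by simp
  have hp: "h \<otimes> p = h"
    using hc gc hg by (simp add: p_def minus_eq r_distr r_minus)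
  have eg: "e \<otimes> g = g"
    using gc hc pc gg hg by (simp add: e_def l_distr m_assoc)
  have he: "h \<otimes> e = h"
    using gc hc pc hg hp hh by (simp add: e_def r_distr m_assoc[symmetric])
  have "e \<otimes> e = e \<otimes> g \<oplus> e \<otimes> (p \<otimes> h)"
    using ec gc hc pc by (subst (2) e_def) (simp add: r_distr)
  also have "e \<otimes> (p \<otimes> h) = (g \<otimes> p) \<otimes> h \<oplus> p \<otimes> ((h \<otimes> p) \<otimes> h)"
    using gc hc pc by (simp add: e_def l_distr m_assoc)
  also have "\<dots> = p \<otimes> h" using gp hp hh hc pc by simp
  finally have "e \<otimes> e = e" using eg by (simp add: e_def)
  then have eid: "idempotent_element R e" using ec by (simp add: idempotent_element_def)
  have "g \<in> I" "h \<in> I"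
    using a(1) x(1) by (simp_all add: g_def h_def I.I_r_closed I.I_l_closed)
  then have eI: "e \<in> I"
    unfolding e_def using pc by (simp add: I.I_l_closed I.a_closed)
  have ga: "g \<otimes> a = a" unfolding g_def using x(2) by simp
  have ah: "a \<otimes> h = a" unfolding h_def using x ac by (simp add: m_assoc)
  have "e \<otimes> a = (e \<otimes> g) \<otimes> a" using ga ec gc ac by (simp add: m_assoc)
  then have "e \<otimes> a = a" using eg ga by simp
  moreover have "a \<otimes> e = a \<otimes> (h \<otimes> e)" using ah ec hc ac by (simp add: m_assoc[symmetric])
  then have "a \<otimes> e = a" using he ah by simp
  ultimately have "a \<in> carrier (corner_ring R e)"
    using ac corner_carrier_iff[OF eid] by simp
  with eI eid show thesis by (rule that)
qed

lemma strongly_regular_corners_imp_reduced: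
  assumes reg: "regular_ideal R I"
    and corners: "\<And>e. e \<in> I \<Longrightarrow> idempotent_element R e \<Longrightarrow> strongly_regular_ring (corner_ring R e)"
  shows "reduced_ideal R I"
proof -
  have I: "ideal I R" using reg by (simp add: regular_ideal_def)
  have "a = \<zero>" if a: "a \<in> I" and sq: "a \<otimes> a = \<zero>" for a
  proof -
    obtain x where x: "x \<in> carrier R" "a = a \<otimes> x \<otimes> a"
      using reg a by (auto simp: regular_ideal_def regular_element_def)
    obtain e where e: "e \<in> I" "idempotent_element R e" and aC: "a \<in> carrier (corner_ring R e)"
      using square_zero_in_corner[OF I a sq x] .
    have "strongly_regular_element (corner_ring R e) a"
      using corners[OF e] aC by (simp add: strongly_regular_ring_def)
    then obtain t where "t \<in> carrier (corner_ring R e)" "a = a \<otimes> a \<otimes> t"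
      using strongly_regular_corner_element_iff[OF e(2) aC] by blast
    then show "a = \<zero>" using sq corner_carrier_iff[OF e(2)] by simp
  qed
  then show ?thesis using I by (simp add: reduced_ideal_def)
qed

end

theorem theorem3p3:
  fixes R :: "('a, 'm) ring_scheme" and I :: "'a set"
  assumes "ring R"
    and "regular_ideal R I"
  shows "square_stable R I \<longleftrightarrow>
    (\<forall>e\<in>I. idempotent_element R e \<longrightarrow> strongly_regular_ring (corner_ring R e))"
proof -
  interpret ring R by (rule assms(1))
  show ?thesis
  proof
    assume "square_stable R I"
    then have "reduced_ideal R I"
      using square_stable_imp_reduced[OF assms(2)] by simp
    then show "\<forall>e\<in>I. idempotent_element R e \<longrightarrow> strongly_regular_ring (corner_ring R e)"
      using reduced_imp_strongly_regular_corner[OF assms(2)] by simp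
  next
    assume "\<forall>e\<in>I. idempotent_element R e \<longrightarrow> strongly_regular_ring (corner_ring R e)"
    then have "reduced_ideal R I"
      using strongly_regular_corners_imp_reduced[OF assms(2)] by simp
    then show "square_stable R I"
      by (rule reduced_imp_square_stable[OF assms(2)])
  qed
qed

end
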